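(* Let $X$ be a locally compact and separable metric space. Let $\mu \in \mathcal{M}_{+}(X)$, let $\mathcal{F}$ be a metric foliation of $X$, with quotient space $X^*$ and quotient map $p:X \to X^*$. If $\mathcal{F}$ is a metric measure foliation of $X$ with $\Omega = X^*$, then the disintegration map of $\mu$ with respect to $\nu=p_{*}\mu$ is weakly continuous.
   Context: $\mathcal{M}_{+}(X)$ is the set of positive finite Radon measures on $X$; $\mathscr{P}(X)$ the set of Borel probability measures on $X$; $W_2(\alpha,\beta)^2=\inf_{\gamma}\int d(x_1,x_2)^2\,d\gamma$ over all $\gamma\in\mathscr{P}(X\times X)$ with marginals $\alpha,\beta$. A foliation $\mathcal F$ of a metric space $(X,d)$ is a partition of $X$ into closed subsets (leaves). It is a metric foliation if $d(F,F')=d(x,F')$ for all $F,F'\in\mathcal F$ and $x\in F$, where $d(F,F')=\inf\{d(x,x'):x\in F,x'\in F'\}$ and $d(x,F')=d(\{x\},F')$. The quotient space $X^*$ is the set of equivalence classes for the relation of lying in the same leaf, $p:X\to X^*$ is the projection (quotient map), and $X^*$ carries the distance $d^*(y,y'):=d(p^{-1}(y),p^{-1}(y'))$. Disintegration of $\mu$ with respect to $\nu=p_*\mu$: a family $\{\mu_y\}_{y\in X^*}$ of measures on $X$ such that $y\mapsto\mu_y(A)$ is Borel for every Borel $A\subset X$, $\mu_y\in\mathscr{P}(X)$ for $\nu$-a.e. $y$, $\mu(A)=\int\mu_y(A)\,d\nu(y)$ for all Borel $A\subset X$, and $\mu_y$ is concentrated on $p^{-1}(y)$ for $\nu$-a.e.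 $y$. The disintegration map of $\mu$ w.r.t. $\nu$ is $f:X^*\to\mathscr{P}(X)$, $f(y)=\mu_y$. A metric foliation $\mathcal F$ of $(X,d,\mu)$ is a metric measure foliation if $p_*\mu$ is a locally finite Borel measure on $X^*$ and there is a Borel set $\Omega\subset X^*$ with $p_*\mu(X^*\setminus\Omega)=0$ such that $W_2(\mu_y,\mu_{y'})=d^*(y,y')$ for all $y,y'\in\Omega$, where $\{\mu_y\}$ is the disintegration of $\mu$ with respect to $p_*\mu$. $f$ is weakly continuous if it is continuous with respect to weak convergence of measures: $y_n\to y$ implies $\int\varphi\,d\mu_{y_n}\to\int\varphi\,d\mu_y$ for every bounded continuous $\varphi$ on $X$. *)

theory Defs
  imports "HOL-Probability.Probability"
begin

section \<open>Metric foliations and their quotient\<close>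

definition foliation :: "'a::metric_space set set \<Rightarrow> bool" where
  "foliation F \<longleftrightarrow> partition_on UNIV F \<and> (\<forall>L\<in>F. closed L)"

definition metric_foliation :: "'a::metric_space set set \<Rightarrow> bool" where
  "metric_foliation F \<longleftrightarrow> foliation F \<and>
     (\<forall>L\<in>F. \<forall>L'\<in>F. \<forall>x\<in>L. setdist L L' = setdist {x} L')"

definition leaf_rel :: "'a set set \<Rightarrow> ('a \<times> 'a) set" where
  "leaf_rel F = {(x, x'). \<exists>L\<in>F. x \<in> L \<and> x' \<in> L}"

definition leaf_space :: "'a set set \<Rightarrow> 'a set set" where
  "leaf_space F = UNIV // leaf_rel F"

definition leaf_proj :: "'a set set \<Rightarrow> 'a \<Rightarrow> 'a set" where
  "leaf_proj F x = leaf_rel F `` {x}"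

definition leaf_dist :: "'a::metric_space set set \<Rightarrow> 'a set \<Rightarrow> 'a set \<Rightarrow> real" where
  "leaf_dist F y y' = setdist (leaf_proj F -` {y}) (leaf_proj F -` {y'})"

definition leaf_topology :: "'a::metric_space set set \<Rightarrow> 'a set topology" where
  "leaf_topology F = Metric_space.mtopology (leaf_space F) (leaf_dist F)"

definition leaf_borel :: "'a::metric_space set set \<Rightarrow> 'a set measure" where
  "leaf_borel F = sigma (leaf_space F) {U. openin (leaf_topology F) U}"

lemma leaf_proj_eq:
  assumes "foliation F" "L \<in> F" "x \<in> L"
  shows "leaf_proj F x = L"
proof -
  have "disjoint F"
    using assms(1) unfolding foliation_def by (blast dest: partition_onD2)
  have "L' = L" if "L' \<in> F" "x \<in> L'" for L'
  proof (rule ccontr)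
    assume "L' \<noteq> L"
    then have "L' \<inter> L = {}"
      by (rule disjointD[OF \<open>disjoint F\<close> that(1) assms(2)])
    then show False using that(2) assms(3) by blast
  qed
  then have "x' \<in> leaf_proj F x \<longleftrightarrow> x' \<in> L" for x'
    using assms(2,3) unfolding leaf_proj_def leaf_rel_def by blast
  then show ?thesis by blast
qed

lemma ex_leaf:
  assumes "foliation F" obtains L where "L \<in> F" "x \<in> L"
  using assms unfolding foliation_def partition_on_def by (metis UNIV_I UnionE)

lemma ex_mem_leaf:
  assumes "foliation F" "L \<in> F" obtains x where "x \<in> L"
  using assms unfolding foliation_def partition_on_def by (metis ex_in_conv)

lemma leaf_proj_in: "foliation F \<Longrightarrow> leaf_proj F x \<in> F"
  by (metis ex_leaf leaf_proj_eq)

lemma mem_leaf_proj: "foliation F \<Longrightarrow> x \<in> leaf_proj F x"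
  by (metis ex_leaf leaf_proj_eq)

lemma leaf_space_eq:
  assumes "foliation F" shows "leaf_space F = F"
proof -
  have "leaf_space F = range (leaf_proj F)"
    unfolding leaf_space_def quotient_def leaf_proj_def by auto
  also have "\<dots> = F"
  proof (intro equalityI subsetI)
    fix L assume "L \<in> F"
    then obtain x where "x \<in> L" using ex_mem_leaf[OF assms] by metis
    then show "L \<in> range (leaf_proj F)"
      using leaf_proj_eq[OF assms \<open>L \<in> F\<close>] by (metis rangeI)
  qed (use leaf_proj_in[OF assms] in auto)
  finally show ?thesis .
qed

lemma leaf_proj_vimage:
  assumes "foliation F" "L \<in> F" shows "leaf_proj F -` {L} = L"
  using leaf_proj_eq[OF assms] mem_leaf_proj[OF assms(1)] by auto

lemma leaf_dist_eq:
  "foliation F \<Longrightarrow> L \<in> F \<Longrightarrow> L' \<in> F \<Longrightarrow> leaf_dist F L L' = setdist L L'"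
  by (simp add: leaf_dist_def leaf_proj_vimage)

lemma metric_foliation_imp_foliation: "metric_foliation F \<Longrightarrow> foliation F"
  unfolding metric_foliation_def by (rule conjunct1)

lemma Metric_space_leaf:
  assumes F: "metric_foliation F"
  shows "Metric_space (leaf_space F) (leaf_dist F)"
proof -
  have fol: "foliation F" using F by (rule metric_foliation_imp_foliation)
  have eqd: "setdist L L' = setdist {x} L'" if "L \<in> F" "L' \<in> F" "x \<in> L" for L L' x
    using F that unfolding metric_foliation_def by blast
  have ne: "\<exists>x. x \<in> L" if "L \<in> F" for L
    using ex_mem_leaf[OF fol that] by metis
  show ?thesis
    unfolding leaf_space_eq[OF fol]
  proof
    fix x y show "0 \<le> leaf_dist F x y" "leaf_dist F x y = leaf_dist F y x"
      by (auto simp: leaf_dist_def setdist_sym)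
  next
    fix L L' assume L: "L \<in> F" "L' \<in> F"
    obtain x where x: "x \<in> L" using ne L by blast
    have "closed L'" "L' \<noteq> {}" using L ne fol by (auto simp: foliation_def)
    then have "setdist {x} L' = 0 \<longleftrightarrow> x \<in> L'"
      by (simp add: setdist_eq_0_sing_1)
    also have "\<dots> \<longleftrightarrow> L = L'"
      using leaf_proj_eq[OF fol] L x by metis
    finally show "leaf_dist F L L' = 0 \<longleftrightarrow> L = L'"
      using leaf_dist_eq[OF fol L] eqd[OF L x] by simp
  next
    fix L M N assume L: "L \<in> F" "M \<in> F" "N \<in> F"
    obtain a where a: "a \<in> M" using ne L by blast
    have "setdist L N \<le> setdist L {a} + setdist {a} N" by (rule setdist_triangle)
    also have "\<dots> = setdist L M + setdist M N"
      using eqd[OF L(2,1) a] eqd[OF L(2,3) a] by (simp add: setdist_sym)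
    finally show "leaf_dist F L N \<le> leaf_dist F L M + leaf_dist F M N"
      using leaf_dist_eq[OF fol] L by simp
  qed
qed

lemma topspace_leaf_topology: "metric_foliation F \<Longrightarrow> topspace (leaf_topology F) = leaf_space F"
  unfolding leaf_topology_def
  by (rule Metric_space.topspace_mtopology[OF Metric_space_leaf])

lemma continuous_leaf_proj:
  assumes "metric_foliation F" "openin (leaf_topology F) U"
  shows "open (leaf_proj F -` U)"
proof -
  interpret Metric_space "leaf_space F" "leaf_dist F"
    by (rule Metric_space_leaf[OF assms(1)])
  have fol: "foliation F" using assms(1) by (rule metric_foliation_imp_foliation)
  have in_sp: "leaf_proj F x \<in> leaf_space F" for x
    by (simp add: leaf_space_eq fol leaf_proj_in)
  show ?thesis
    unfolding open_dist
  proof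
    fix x assume "x \<in> leaf_proj F -` U"
    then obtain r where r: "r > 0" "mball (leaf_proj F x) r \<subseteq> U"
      using assms(2) unfolding leaf_topology_def openin_mtopology by auto
    have "leaf_proj F x' \<in> U" if "dist x' x < r" for x'
    proof -
      have "leaf_dist F (leaf_proj F x) (leaf_proj F x') \<le> dist x x'"
        unfolding leaf_dist_def by (rule setdist_le_dist) auto
      with that have "leaf_proj F x' \<in> mball (leaf_proj F x) r"
        using in_sp by (auto simp: in_mball dist_commute)
      then show ?thesis using r by blast
    qed
    then show "\<exists>e>0. \<forall>x'. dist x' x < e \<longrightarrow> x' \<in> leaf_proj F -` U"
      using r(1) by auto
  qed
qed

lemma measurable_leaf_proj:
  assumes "metric_foliation F"
  shows "leaf_proj F \<in> borel \<rightarrow>\<^sub>M leaf_borel F"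
  unfolding leaf_borel_def
proof (rule measurable_sigma_sets)
  show "sets (sigma (leaf_space F) {U. openin (leaf_topology F) U})
      = sigma_sets (leaf_space F) {U. openin (leaf_topology F) U}"
    by (rule sets_measure_of) (use topspace_leaf_topology[OF assms] openin_subset in blast)
  show "{U. openin (leaf_topology F) U} \<subseteq> Pow (leaf_space F)"
    using topspace_leaf_topology[OF assms] openin_subset by blast
  show "leaf_proj F \<in> space borel \<rightarrow> leaf_space F"
    using metric_foliation_imp_foliation[OF assms] by (simp add: leaf_space_eq leaf_proj_in)
  show "leaf_proj F -` U \<inter> space borel \<in> sets borel"
    if "U \<in> {U. openin (leaf_topology F) U}" for U
    using continuous_leaf_proj[OF assms] that by simp
qed

section \<open>Measures\<close>

definition finite_radon_measure :: "'a::topological_space measure \<Rightarrow> bool" where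
  "finite_radon_measure \<mu> \<longleftrightarrow> sets \<mu> = sets borel \<and> finite_measure \<mu> \<and>
     (\<forall>A\<in>sets borel. emeasure \<mu> A = (SUP K\<in>{K. compact K \<and> K \<subseteq> A}. emeasure \<mu> K))"

definition borel_prob_measures :: "'a::topological_space measure set" where
  "borel_prob_measures = {\<alpha>. sets \<alpha> = sets borel \<and> prob_space \<alpha>}"

definition couplings :: "'a::metric_space measure \<Rightarrow> 'a measure \<Rightarrow> ('a \<times> 'a) measure set" where
  "couplings \<alpha> \<beta> = {\<gamma>\<in>borel_prob_measures. distr \<gamma> borel fst = \<alpha> \<and> distr \<gamma> borel snd = \<beta>}"

text \<open>The infimum is taken in the extended reals, so \<open>W2 \<alpha> \<beta> = \<infinity>\<close> when there is no
  coupling (in particular, when \<open>\<alpha>\<close> or \<open>\<beta>\<close> is not a Borel probability measure) or every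
  coupling has infinite cost.\<close>

definition W2 :: "'a::metric_space measure \<Rightarrow> 'a measure \<Rightarrow> ennreal" where
  "W2 \<alpha> \<beta> =
     (let c = (INF \<gamma>\<in>couplings \<alpha> \<beta>. \<integral>\<^sup>+ z. ennreal ((dist (fst z) (snd z))\<^sup>2) \<partial>\<gamma>)
      in if c = \<infinity> then \<infinity> else ennreal (sqrt (enn2real c)))"

definition leaf_measure :: "'a::metric_space measure \<Rightarrow> 'a set set \<Rightarrow> 'a set measure" where
  "leaf_measure \<mu> F = distr \<mu> (leaf_borel F) (leaf_proj F)"

text \<open>A disintegration is determined only up to a null set of leaves, so the family \<open>m\<close> is an
  explicit argument here and below; its values outside \<open>leaf_space F\<close> are irrelevant.\<close>

definition disintegration ::
    "'a::metric_space measure \<Rightarrow> 'a set set \<Rightarrow> ('a set \<Rightarrow> 'a measure) \<Rightarrow> bool" where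
  "disintegration \<mu> F m \<longleftrightarrow>
     (\<forall>y\<in>leaf_space F. sets (m y) = sets borel) \<and>
     (\<forall>A\<in>sets borel. (\<lambda>y. emeasure (m y) A) \<in> borel_measurable (leaf_borel F)) \<and>
     (AE y in leaf_measure \<mu> F. m y \<in> borel_prob_measures) \<and>
     (\<forall>A\<in>sets borel. emeasure \<mu> A = (\<integral>\<^sup>+ y. emeasure (m y) A \<partial>leaf_measure \<mu> F)) \<and>
     (AE y in leaf_measure \<mu> F. emeasure (m y) (- (leaf_proj F -` {y})) = 0)"

definition metric_measure_foliation ::
    "'a::metric_space measure \<Rightarrow> 'a set set \<Rightarrow> ('a set \<Rightarrow> 'a measure) \<Rightarrow> 'a set set \<Rightarrow> bool" where
  "metric_measure_foliation \<mu> F m \<Omega> \<longleftrightarrow>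
     metric_foliation F \<and>
     (\<forall>y\<in>leaf_space F. \<exists>U. openin (leaf_topology F) U \<and> y \<in> U \<and>
        emeasure (leaf_measure \<mu> F) U < \<infinity>) \<and>
     disintegration \<mu> F m \<and>
     \<Omega> \<in> sets (leaf_borel F) \<and>
     emeasure (leaf_measure \<mu> F) (leaf_space F - \<Omega>) = 0 \<and>
     (\<forall>y\<in>\<Omega>. \<forall>y'\<in>\<Omega>. W2 (m y) (m y') = ennreal (leaf_dist F y y'))"

definition weakly_continuous ::
    "'a::metric_space set set \<Rightarrow> ('a set \<Rightarrow> 'a measure) \<Rightarrow> bool" where
  "weakly_continuous F f \<longleftrightarrow>
     f \<in> leaf_space F \<rightarrow> borel_prob_measures \<and>
     (\<forall>s y. (\<forall>n::nat. s n \<in> leaf_space F) \<longrightarrow> y \<in> leaf_space F \<longrightarrow>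
        limitin (leaf_topology F) s y sequentially \<longrightarrow>
        (\<forall>\<phi>::'a \<Rightarrow> real. continuous_on UNIV \<phi> \<longrightarrow> bounded (range \<phi>) \<longrightarrow>
          (\<lambda>n. \<integral>x. \<phi> x \<partial>f (s n)) \<longlonglongrightarrow> (\<integral>x. \<phi> x \<partial>f y)))"

end

theory Submission
  imports Defs
begin

text \<open>If \<open>\<gamma>\<close> couples \<open>\<alpha>\<close> and \<open>\<beta>\<close>, then the integrals of a bounded continuous function \<open>\<phi>\<close> differ
  by at most \<open>\<integral> \<bar>\<phi> x - \<phi> x'\<bar> d\<gamma>(x, x')\<close>. Pairs at distance at least \<open>r\<close> are controlled by the
  quadratic cost of \<open>\<gamma>\<close>. Closer pairs contribute little unless \<open>x'\<close> lies in the open set where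
  \<open>\<phi>\<close> oscillates by more than \<open>e\<close> at scale \<open>r\<close>, and the \<open>\<beta>\<close>-measure of that set vanishes as
  \<open>r\<close> tends to 0. Hence convergence in \<open>W2\<close> to a fixed \<open>\<beta>\<close> implies weak convergence, and
  \<open>W2 (m y) (m y') = leaf_dist F y y'\<close> on all leaves gives the theorem.\<close>

text \<open>Both inequalities are strict so that, for continuous \<phi>, the set is a union over
  \<open>x\<close> of open sets and hence Borel.\<close>

definition oscillation_set :: "('a::metric_space \<Rightarrow> real) \<Rightarrow> real \<Rightarrow> real \<Rightarrow> 'a set" where
  "oscillation_set \<phi> e r = {x'. \<exists>x. dist x x' < r \<and> e < \<bar>\<phi> x - \<phi> x'\<bar>}"

lemma open_oscillation_set:
  assumes "continuous_on UNIV \<phi>"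
  shows "open (oscillation_set \<phi> e r)"
proof -
  have "oscillation_set \<phi> e r = (\<Union>x. {x'. dist x x' < r} \<inter> {x'. e < \<bar>\<phi> x - \<phi> x'\<bar>})"
    by (auto simp: oscillation_set_def)
  moreover have "open ({x'. dist x x' < r} \<inter> {x'. e < \<bar>\<phi> x - \<phi> x'\<bar>})" for x
    by (intro open_Int open_Collect_less continuous_intros assms)
  ultimately show ?thesis by auto
qed

text \<open>The sets decrease as the scale shrinks, and a point in all of them would violate
  continuity of \<phi> there. So their intersection is empty and continuity from above of a finite
  measure applies. No uniform continuity is involved.\<close>

lemma measure_oscillation_set_tendsto_0:
  fixes \<beta> :: "'a::metric_space measure"
  assumes "finite_measure \<beta>" "sets \<beta> = sets borel" "continuous_on UNIV \<phi>" "e > 0"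
  shows "(\<lambda>n. measure \<beta> (oscillation_set \<phi> e (1 / real (Suc n)))) \<longlonglongrightarrow> 0"
proof -
  interpret finite_measure \<beta> by fact
  let ?A = "\<lambda>n. oscillation_set \<phi> e (1 / real (Suc n))"
  have sub: "?A n \<subseteq> ?A k" if "k \<le> n" for k n
  proof -
    have "1 / real (Suc n) \<le> 1 / real (Suc k)"
      using that by (simp add: frac_le)
    then show ?thesis unfolding oscillation_set_def by (blast intro: less_le_trans)
  qed
  have "x \<notin> (\<Inter>n. ?A n)" for x
  proof
    assume x: "x \<in> (\<Inter>n. ?A n)"
    obtain d where "d > 0" and d: "\<And>y. dist y x < d \<Longrightarrow> dist (\<phi> y) (\<phi> x) < e"
      using assms(3,4) unfolding continuous_on_iff by (metis UNIV_I)
    obtain n where "1 / real (Suc n) < d"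
      using \<open>d > 0\<close> nat_approx_posE by blast
    moreover obtain y where "dist y x < 1 / real (Suc n)" "e < \<bar>\<phi> y - \<phi> x\<bar>"
      using x by (auto simp: oscillation_set_def)
    ultimately show False using d[of y] by (simp add: dist_real_def)
  qed
  then have "(\<Inter>n. ?A n) = {}" by blast
  moreover have "range ?A \<subseteq> sets \<beta>"
    using open_oscillation_set[OF assms(3)] by (auto simp: assms(2))
  ultimately show ?thesis
    using finite_Lim_measure_decseq[of ?A] sub by (simp add: decseq_def)
qed

text \<open>Couplings live on the Borel sets of the product space, which can form a larger
  sigma-algebra than the product one. Measurability of the cost and of the projections is therefore
  drawn from continuity.\<close>

lemma dist_squared_borel_measurable [measurable]:
  "(\<lambda>z::'a::metric_space \<times> 'a. (dist (fst z) (snd z))\<^sup>2) \<in> borel_measurable borel"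
  by (intro borel_measurable_continuous_onI continuous_intros)

lemma fst_borel_measurable [measurable]: "fst \<in> borel \<rightarrow>\<^sub>M (borel :: 'a::topological_space measure)"
  and snd_borel_measurable [measurable]: "snd \<in> borel \<rightarrow>\<^sub>M (borel :: 'b::topological_space measure)"
  by (intro borel_measurable_continuous_onI continuous_intros)+

lemma couplings_marginals_prob:
  assumes "\<gamma> \<in> couplings \<alpha> \<beta>"
  shows "\<alpha> \<in> borel_prob_measures" "\<beta> \<in> borel_prob_measures"
proof -
  interpret prob_space \<gamma> using assms by (simp add: couplings_def borel_prob_measures_def)
  have \<gamma>: "sets \<gamma> = sets borel" "distr \<gamma> borel fst = \<alpha>" "distr \<gamma> borel snd = \<beta>"
    using assms by (auto simp: couplings_def borel_prob_measures_def)
  have "prob_space (distr \<gamma> borel fst)" "prob_space (distr \<gamma> borel snd)"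
    by (auto intro!: prob_space_distr simp: measurable_cong_sets[OF \<gamma>(1) refl])
  then show "\<alpha> \<in> borel_prob_measures" "\<beta> \<in> borel_prob_measures"
    using \<gamma> by (auto simp: borel_prob_measures_def)
qed

lemma W2_less_imp_coupling:
  assumes "W2 \<alpha> \<beta> < ennreal d"
  obtains \<gamma> where "\<gamma> \<in> couplings \<alpha> \<beta>"
    "(\<integral>\<^sup>+ z. ennreal ((dist (fst z) (snd z))\<^sup>2) \<partial>\<gamma>) < ennreal (d\<^sup>2)"
proof -
  define c where "c = (INF \<gamma>\<in>couplings \<alpha> \<beta>. \<integral>\<^sup>+ z. ennreal ((dist (fst z) (snd z))\<^sup>2) \<partial>\<gamma>)"
  have W: "W2 \<alpha> \<beta> = (if c = \<infinity> then \<infinity> else ennreal (sqrt (enn2real c)))"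
    by (simp add: W2_def c_def Let_def)
  with assms have c: "c \<noteq> \<infinity>" "sqrt (enn2real c) < d"
    by (auto split: if_splits simp: ennreal_less_iff)
  then have "enn2real c < d\<^sup>2"
    by (metis enn2real_nonneg real_sqrt_ge_zero real_sqrt_pow2 power_strict_mono zero_less_numeral)
  \<comment> \<open>Finiteness of \<open>c\<close> matters here, since \<open>enn2real\<close> sends
    infinity to 0.\<close>
  then have "c < ennreal (d\<^sup>2)"
    using c(1) by (metis enn2real_nonneg ennreal_enn2real_if ennreal_less_iff infinity_ennreal_def)
  then show ?thesis
    using that unfolding c_def INF_less_iff by blast
qed

text \<open>The radius \<open>d\<close> is fixed before \<alpha>, so a single \<open>d\<close>
  serves a whole sequence of measures approaching \<beta>.\<close>

lemma W2_small_imp_integral_close: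
  fixes \<beta> :: "'a::metric_space measure" and \<phi> :: "'a \<Rightarrow> real"
  assumes \<beta>: "\<beta> \<in> borel_prob_measures"
    and cont: "continuous_on UNIV \<phi>" and bdd: "bounded (range \<phi>)" and "e > 0"
  obtains d where "d > 0"
    "\<And>\<alpha>. W2 \<alpha> \<beta> < ennreal d \<Longrightarrow> \<bar>(\<integral>x. \<phi> x \<partial>\<alpha>) - (\<integral>x. \<phi> x \<partial>\<beta>)\<bar> < e"
proof -
  obtain B where "B > 0" and B: "\<And>x. \<bar>\<phi> x\<bar> \<le> B"
    using bdd unfolding bounded_pos by auto
  have [measurable]: "\<phi> \<in> borel_measurable borel"
    using cont by (rule borel_measurable_continuous_onI)
  interpret \<beta>: prob_space \<beta> using \<beta> by (simp add: borel_prob_measures_def)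
  have sets_\<beta>: "sets \<beta> = sets borel" using \<beta> by (simp add: borel_prob_measures_def)
  have "\<forall>\<^sub>F n in sequentially. measure \<beta> (oscillation_set \<phi> (e / 3) (1 / real (Suc n))) < e / (6 * B)"
    using measure_oscillation_set_tendsto_0[OF \<beta>.finite_measure_axioms sets_\<beta> cont, of "e / 3"]
      \<open>e > 0\<close> \<open>B > 0\<close> by (intro order_tendstoD(2)) auto
  then obtain n where n: "measure \<beta> (oscillation_set \<phi> (e / 3) (1 / real (Suc n))) < e / (6 * B)"
    by (auto simp: eventually_sequentially)
  define r where "r = 1 / real (Suc n)"
  define A where "A = oscillation_set \<phi> (e / 3) r"
  \<comment> \<open>Chosen so that \<open>2 * B / r\<^sup>2 * d\<^sup>2 = e / 3\<close>; likewise
    \<open>e / (6 * B)\<close> turns into \<open>e / 3\<close> under the weight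
    \<open>2 * B\<close>.\<close>
  define d where "d = r * sqrt (e / (6 * B))"
  have "r > 0" by (simp add: r_def)
  have A: "measure \<beta> A < e / (6 * B)" using n by (simp add: A_def r_def)
  have [measurable]: "A \<in> sets borel"
    unfolding A_def by (intro borel_open open_oscillation_set cont)
  \<comment> \<open>The trivial bound \<open>2 * B\<close> is absorbed by the indicator if
    \<open>x'\<close> lies in \<open>A\<close>, and by the quadratic term, as in Chebyshev's
    inequality, if the distance is at least \<open>r\<close>. Otherwise the definition of
    \<open>A\<close> gives \<open>e / 3\<close>.\<close>
  have pointwise: "\<bar>\<phi> x - \<phi> x'\<bar> \<le> e / 3 + 2 * B * indicator A x' + 2 * B / r\<^sup>2 * (dist x x')\<^sup>2" for x x'
  proof -
    have le: "\<bar>\<phi> x - \<phi> x'\<bar> \<le> 2 * B" using B[of x] B[of x'] by linarith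
    have nonneg: "0 \<le> 2 * B / r\<^sup>2 * (dist x x')\<^sup>2" using \<open>B > 0\<close> by simp
    consider "x' \<in> A" | "r \<le> dist x x'" | "\<bar>\<phi> x - \<phi> x'\<bar> \<le> e / 3"
      unfolding A_def oscillation_set_def mem_Collect_eq by (meson not_le)
    then show ?thesis
    proof cases
      case 1
      then have "2 * B * indicator A x' = 2 * B" by simp
      then show ?thesis using le nonneg \<open>e > 0\<close> by linarith
    next
      case 2
      then have "1 \<le> (dist x x' / r)\<^sup>2" using \<open>r > 0\<close> by simp
      then have "2 * B * 1 \<le> 2 * B * (dist x x' / r)\<^sup>2"
        using \<open>B > 0\<close> by (intro mult_left_mono) auto
      then have "2 * B \<le> 2 * B / r\<^sup>2 * (dist x x')\<^sup>2" by (simp add: power_divide)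
      moreover have "0 \<le> 2 * B * indicator A x'" using \<open>B > 0\<close> by simp
      ultimately show ?thesis using le \<open>e > 0\<close> by linarith
    next
      case 3
      moreover have "0 \<le> 2 * B * indicator A x'" using \<open>B > 0\<close> by simp
      ultimately show ?thesis using nonneg by linarith
    qed
  qed
  show ?thesis
  proof (rule that[of d])
    show "d > 0" using \<open>r > 0\<close> \<open>e > 0\<close> \<open>B > 0\<close> by (simp add: d_def)
    fix \<alpha> assume "W2 \<alpha> \<beta> < ennreal d"
    then obtain \<gamma> where \<gamma>: "\<gamma> \<in> couplings \<alpha> \<beta>"
      and cost: "(\<integral>\<^sup>+ z. ennreal ((dist (fst z) (snd z))\<^sup>2) \<partial>\<gamma>) < ennreal (d\<^sup>2)"
      by (rule W2_less_imp_coupling)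
    interpret \<gamma>: prob_space \<gamma> using \<gamma> by (simp add: couplings_def borel_prob_measures_def)
    have [measurable_cong]: "sets \<gamma> = sets borel" and \<alpha>: "\<alpha> = distr \<gamma> borel fst"
      and \<beta>_eq: "\<beta> = distr \<gamma> borel snd"
      using \<gamma> by (auto simp: couplings_def borel_prob_measures_def)
    let ?c = "\<lambda>z::'a \<times> 'a. (dist (fst z) (snd z))\<^sup>2"
    \<comment> \<open>Finite cost gives genuine integrability; the Bochner integral would otherwise
      default to 0 and the bound would say nothing.\<close>
    have int_c: "integrable \<gamma> ?c"
      using cost by (intro integrableI_nonneg) (auto intro: less_trans)
    have "ennreal (\<integral>z. ?c z \<partial>\<gamma>) < ennreal (d\<^sup>2)"
      using cost nn_integral_eq_integral[OF int_c] by simp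
    then have c_less: "(\<integral>z. ?c z \<partial>\<gamma>) < d\<^sup>2"
      by (simp add: ennreal_less_iff)
    have int_\<phi>: "integrable \<gamma> (\<lambda>z. \<phi> (fst z))" "integrable \<gamma> (\<lambda>z. \<phi> (snd z))"
      by (rule \<gamma>.integrable_const_bound[where B = B]; simp add: B)+
    have int_A: "integrable \<gamma> (\<lambda>z. indicator A (snd z) :: real)"
      by (rule \<gamma>.integrable_const_bound[where B = 1]) auto
    have "(\<integral>z. indicator A (snd z) \<partial>\<gamma>) = (\<integral>x. indicator A x \<partial>\<beta> :: real)"
      unfolding \<beta>_eq by (subst integral_distr) auto
    then have A_eq: "(\<integral>z. indicator A (snd z) \<partial>\<gamma>) = measure \<beta> A"
      by (simp add: sets_eq_imp_space_eq[OF sets_\<beta>])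
    have "(\<integral>x. \<phi> x \<partial>\<alpha>) - (\<integral>x. \<phi> x \<partial>\<beta>) = (\<integral>z. \<phi> (fst z) - \<phi> (snd z) \<partial>\<gamma>)"
      unfolding \<alpha> \<beta>_eq using int_\<phi> by (simp add: integral_distr)
    also have "\<bar>\<dots>\<bar> \<le> (\<integral>z. \<bar>\<phi> (fst z) - \<phi> (snd z)\<bar> \<partial>\<gamma>)"
      by (rule integral_abs_bound)
    also have "\<dots> \<le> (\<integral>z. e / 3 + 2 * B * indicator A (snd z) + 2 * B / r\<^sup>2 * ?c z \<partial>\<gamma>)"
      using int_\<phi> int_A int_c by (intro integral_mono pointwise) auto
    also have "\<dots> = e / 3 + 2 * B * measure \<beta> A + 2 * B / r\<^sup>2 * (\<integral>z. ?c z \<partial>\<gamma>)"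
      using int_A int_c by (simp add: A_eq \<gamma>.prob_space)
    \<comment> \<open>Each of the three terms on the right equals \<open>e / 3\<close>.\<close>
    also have "\<dots> < e / 3 + 2 * B * (e / (6 * B)) + 2 * B / r\<^sup>2 * d\<^sup>2"
      using A c_less \<open>B > 0\<close> \<open>r > 0\<close>
      by (intro add_strict_mono add_strict_left_mono mult_strict_left_mono) auto
    also have "\<dots> = e"
      using \<open>B > 0\<close> \<open>r > 0\<close> \<open>e > 0\<close> by (simp add: d_def power_mult_distrib field_simps)
    finally show "\<bar>(\<integral>x. \<phi> x \<partial>\<alpha>) - (\<integral>x. \<phi> x \<partial>\<beta>)\<bar> < e" .
  qed
qed

theorem proposition5p8:
  fixes \<mu> :: "'a::metric_space measure"
    and F :: "'a set set"
    and m :: "'a set \<Rightarrow> 'a measure"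
  assumes "locally_compact_space (euclidean :: 'a topology)"
    and "separable_space (euclidean :: 'a topology)"
    and "finite_radon_measure \<mu>"
    and "metric_foliation F"
    and "disintegration \<mu> F m"
    and "metric_measure_foliation \<mu> F m (leaf_space F)"
  shows "weakly_continuous F m"
proof -
  interpret Metric_space "leaf_space F" "leaf_dist F"
    by (rule Metric_space_leaf[OF assms(4)])
  have W2_eq: "W2 (m y) (m y') = ennreal (leaf_dist F y y')"
    if "y \<in> leaf_space F" "y' \<in> leaf_space F" for y y'
    using assms(6) that unfolding metric_measure_foliation_def by blast
  \<comment> \<open>The disintegration yields probability measures only almost everywhere. On every
    leaf, \<open>W2 (m y) (m y) = 0\<close> is finite, so a coupling exists and forces its marginal
    \<open>m y\<close> to be a probability measure.\<close>
  have prob: "m y \<in> borel_prob_measures" if "y \<in> leaf_space F" for y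
  proof -
    have "W2 (m y) (m y) < ennreal 1" using W2_eq[OF that that] that by simp
    then show ?thesis
      by (rule W2_less_imp_coupling) (rule couplings_marginals_prob)
  qed
  have "(\<lambda>n. \<integral>x. \<phi> x \<partial>m (s n)) \<longlonglongrightarrow> (\<integral>x. \<phi> x \<partial>m y)"
    if s: "\<And>n. s n \<in> leaf_space F" and y: "y \<in> leaf_space F"
      and lim: "limitin (leaf_topology F) s y sequentially"
      and \<phi>: "continuous_on UNIV \<phi>" "bounded (range \<phi>)"
    for s y and \<phi> :: "'a \<Rightarrow> real"
  proof (rule tendstoI)
    fix e :: real assume "e > 0"
    then obtain d where "d > 0" and
      d: "\<And>\<alpha>. W2 \<alpha> (m y) < ennreal d \<Longrightarrow> \<bar>(\<integral>x. \<phi> x \<partial>\<alpha>) - (\<integral>x. \<phi> x \<partial>m y)\<bar> < e"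
      using W2_small_imp_integral_close[OF prob[OF y] \<phi>] by metis
    have "\<forall>\<^sub>F n in sequentially. leaf_dist F (s n) y < d"
      using lim \<open>d > 0\<close> unfolding leaf_topology_def limitin_metric
      by (auto elim: eventually_mono)
    then show "\<forall>\<^sub>F n in sequentially. dist (\<integral>x. \<phi> x \<partial>m (s n)) (\<integral>x. \<phi> x \<partial>m y) < e"
    proof eventually_elim
      case (elim n)
      then have "W2 (m (s n)) (m y) < ennreal d"
        using W2_eq[OF s y] by (simp add: ennreal_less_iff)
      then show ?case using d by (simp add: dist_real_def)
    qed
  qed
  then show ?thesis
    using prob unfolding weakly_continuous_def by blast
qed

end
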